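(* Let $X$ be a topological space such that $|X|\geq\mathfrak b$. Then $X$ is not H-nw-selective.
   Context: A network for a space $X$ is a family $\mathcal N$ of subsets of $X$ such that for every $x\in X$ and every open neighbourhood $U$ of $x$ there is $N\in\mathcal N$ with $x\in N\subseteq U$. The net weight $nw(X)$ is the least cardinality of a network for $X$; $nw(X)=\omega$ is understood as: $X$ has a countable network. A space $X$ is H-nw-selective if $nw(X)=\omega$ and for every sequence $(\mathcal N_n:n\in\omega)$ of countable networks for $X$ one can select finite $\mathcal F_n\subset\mathcal N_n$, $n\in\omega$, such that for any $x\in X$ and any open neighbourhood $U$ of $x$ there exists $k\in\omega$ such that for every $n\geq k$ there exists $A\in\mathcal F_n$ with $x\in A\subseteq U$. For $f,g\in\omega^\omega$, $f\leq^* g$ means $f(n)\leq g(n)$ for all but finitely many $n$. A set $B\subseteq\omega^\omega$ is bounded if there is $g\in\omega^\omega$ with $f\leq^* g$ for all $f\in B$; $\mathfrak b$ is the minimal cardinality of an unbounded subset of $\omega^\omega$. *)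

theory Defs
  imports "HOL-Analysis.Abstract_Topology" "HOL-Library.Countable_Set"
begin

unbundle cardinal_syntax

definition network :: "'a topology \<Rightarrow> 'a set set \<Rightarrow> bool" where
  "network X \<N> \<longleftrightarrow> \<N> \<subseteq> Pow (topspace X) \<and>
     (\<forall>x\<in>topspace X. \<forall>U. openin X U \<and> x \<in> U \<longrightarrow> (\<exists>N\<in>\<N>. x \<in> N \<and> N \<subseteq> U))"

text \<open>The condition \<open>nw(X) = \<omega>\<close> is read as: \<open>X\<close> has a countable (possibly finite) network.\<close>

definition has_countable_network :: "'a topology \<Rightarrow> bool" where
  "has_countable_network X \<longleftrightarrow> (\<exists>\<N>. network X \<N> \<and> countable \<N>)"

definition H_nw_selective :: "'a topology \<Rightarrow> bool" where
  "H_nw_selective X \<longleftrightarrow> has_countable_network X \<and>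
     (\<forall>\<N> :: nat \<Rightarrow> 'a set set. (\<forall>n. network X (\<N> n) \<and> countable (\<N> n)) \<longrightarrow>
        (\<exists>\<F> :: nat \<Rightarrow> 'a set set. (\<forall>n. finite (\<F> n) \<and> \<F> n \<subseteq> \<N> n) \<and>
           (\<forall>x\<in>topspace X. \<forall>U. openin X U \<and> x \<in> U \<longrightarrow>
              (\<exists>k. \<forall>n\<ge>k. \<exists>A\<in>\<F> n. x \<in> A \<and> A \<subseteq> U))))"

definition le_star :: "(nat \<Rightarrow> nat) \<Rightarrow> (nat \<Rightarrow> nat) \<Rightarrow> bool" (infix "\<le>\<^sup>*" 50) where
  "f \<le>\<^sup>* g \<longleftrightarrow> finite {n. \<not> f n \<le> g n}"

definition le_star_bounded :: "(nat \<Rightarrow> nat) set \<Rightarrow> bool" where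
  "le_star_bounded B \<longleftrightarrow> (\<exists>g. \<forall>f\<in>B. f \<le>\<^sup>* g)"

text \<open>Cardinals are represented by cardinal orders, so the number \<open>\<bb>\<close> is determined only up to
  order isomorphism: it is the cardinality of an unbounded set of least cardinality.\<close>

definition bounding_number :: "(nat \<Rightarrow> nat) rel" where
  "bounding_number = (SOME \<kappa>.
     (\<exists>B. \<not> le_star_bounded B \<and> \<kappa> = |B| ) \<and>
     (\<forall>C. \<not> le_star_bounded C \<longrightarrow> \<kappa> \<le>o |C| ))"

lemma not_le_star_bounded_UNIV: "\<not> le_star_bounded UNIV"
proof
  assume "le_star_bounded UNIV"
  then obtain g where "\<And>f. f \<le>\<^sup>* g"
    by (auto simp: le_star_bounded_def)
  from this[of "\<lambda>n. Suc (g n)"] show False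
    by (simp add: le_star_def)
qed

lemma bounding_number:
  shows bounding_number_attained: "\<exists>B. \<not> le_star_bounded B \<and> bounding_number = |B|"
    and bounding_number_least: "\<not> le_star_bounded C \<Longrightarrow> bounding_number \<le>o |C|"
proof -
  let ?R = "{ |B| | B. \<not> le_star_bounded B}"
  have "\<exists>\<kappa>\<in>?R. \<forall>\<kappa>'\<in>?R. \<kappa> \<le>o \<kappa>'"
    by (rule exists_minim_Card_order) (use not_le_star_bounded_UNIV card_of_Card_order in blast)+
  then have "\<exists>\<kappa>. (\<exists>B. \<not> le_star_bounded B \<and> \<kappa> = |B| ) \<and>
     (\<forall>C. \<not> le_star_bounded C \<longrightarrow> \<kappa> \<le>o |C| )"
    by blast
  from someI_ex[OF this, folded bounding_number_def]
  show "\<exists>B. \<not> le_star_bounded B \<and> bounding_number = |B|"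
    and "\<not> le_star_bounded C \<Longrightarrow> bounding_number \<le>o |C|"
    by blast+
qed

end

theory Submission
  imports Defs
begin

text \<open>
  A countable network can be cut along the fibres of any function from the space to the naturals
  without losing countability or the network property. So, given a family of sequences
  \<open>h x :: nat \<Rightarrow> nat\<close> indexed by the points \<open>x\<close>, one can arrange that the \<open>n\<close>-th network consists
  of sets on which \<open>\<lambda>x. h x n\<close> is constant. A finite selection from it then involves only finitely
  many values of the \<open>n\<close>-th coordinate; let \<open>g n\<close> bound them. The H-nw-selective
  property, applied to the open set \<open>topspace X\<close>, puts every \<open>x\<close> into a selected set for almost
  all \<open>n\<close>, which says that \<open>h x\<close> is eventually dominated by \<open>g\<close>.

  Hence all images of an H-nw-selective space in \<open>nat \<Rightarrow> nat\<close>, under arbitrary functions, are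
  bounded (\<open>H_nw_selective_imp_le_star_bounded_image\<close>). A space with at least \<open>\<bb>\<close> points, however,
  can be mapped onto an unbounded family.
\<close>

lemma network_refine_by_fibres:
  assumes "network X \<N>"
  shows "network X {N \<inter> c -` {m} | N m. N \<in> \<N>}"
  unfolding network_def
proof (intro conjI ballI allI impI)
  show "{N \<inter> c -` {m} | N m. N \<in> \<N>} \<subseteq> Pow (topspace X)"
    using assms by (auto simp: network_def)
next
  fix x U assume "x \<in> topspace X" "openin X U \<and> x \<in> U"
  then obtain N where "N \<in> \<N>" "x \<in> N" "N \<subseteq> U"
    using assms unfolding network_def by meson
  then show "\<exists>M\<in>{N \<inter> c -` {m} | N m. N \<in> \<N>}. x \<in> M \<and> M \<subseteq> U"
    by (intro bexI[of _ "N \<inter> c -` {c x}"]) auto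
qed

lemma countable_refine_by_fibres:
  fixes c :: "'a \<Rightarrow> 'b::countable"
  assumes "countable \<N>"
  shows "countable {N \<inter> c -` {m} | N m. N \<in> \<N>}"
proof -
  have "{N \<inter> c -` {m} | N m. N \<in> \<N>} = (\<lambda>(N, m). N \<inter> c -` {m}) ` (\<N> \<times> UNIV)"
    by auto
  then show ?thesis
    using assms by simp
qed

lemma finite_image_Union_fibre_subsets:
  assumes "finite \<F>" and "\<And>A. A \<in> \<F> \<Longrightarrow> \<exists>m. A \<subseteq> c -` {m}"
  shows "finite (c ` \<Union>\<F>)"
proof -
  have "finite (c ` A)" if "A \<in> \<F>" for A
  proof -
    obtain m where "A \<subseteq> c -` {m}"
      using assms(2) \<open>A \<in> \<F>\<close> by blast
    then have "c ` A \<subseteq> {m}"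
      by auto
    then show ?thesis
      using finite_subset by blast
  qed
  then show ?thesis
    using assms(1) by (simp add: image_Union)
qed

text \<open>
  Being H-nw-selective thus entails a Hurewicz-type property of the underlying set: the sequences
  \<open>h x\<close> code, for each \<open>n\<close>, the partition of the space according to the value of \<open>h x n\<close>, and finitely
  many pieces of each partition have to catch every point from some \<open>n\<close> on.
\<close>

lemma H_nw_selective_imp_le_star_bounded_image:
  fixes h :: "'a \<Rightarrow> nat \<Rightarrow> nat"
  assumes "H_nw_selective X"
  shows "le_star_bounded (h ` topspace X)"
proof -
  obtain \<N> where \<N>: "network X \<N>" "countable \<N>"
    using assms unfolding H_nw_selective_def has_countable_network_def by blast
  define \<M> where "\<M> n = {N \<inter> (\<lambda>x. h x n) -` {m} | N m. N \<in> \<N>}" for n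
  have "\<forall>n. network X (\<M> n) \<and> countable (\<M> n)"
    unfolding \<M>_def using \<N> network_refine_by_fibres countable_refine_by_fibres by blast
  then obtain \<F> where \<F>: "\<And>n. finite (\<F> n)" "\<And>n. \<F> n \<subseteq> \<M> n"
    and catch: "\<And>x U. x \<in> topspace X \<Longrightarrow> openin X U \<and> x \<in> U \<Longrightarrow>
                  \<exists>k. \<forall>n\<ge>k. \<exists>A\<in>\<F> n. x \<in> A \<and> A \<subseteq> U"
    using assms unfolding H_nw_selective_def by metis
  define V where "V n = (\<lambda>x. h x n) ` \<Union>(\<F> n)" for n
  have fin: "finite (V n)" for n
    unfolding V_def
  proof (rule finite_image_Union_fibre_subsets[OF \<F>(1)])
    fix A assume "A \<in> \<F> n"
    then show "\<exists>m. A \<subseteq> (\<lambda>x. h x n) -` {m}"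
      using \<F>(2)[of n] unfolding \<M>_def by blast
  qed
  have "h x \<le>\<^sup>* (\<lambda>n. Max (V n))" if "x \<in> topspace X" for x
  proof -
    obtain k where k: "\<forall>n\<ge>k. \<exists>A\<in>\<F> n. x \<in> A \<and> A \<subseteq> topspace X"
      using catch[of x "topspace X"] \<open>x \<in> topspace X\<close> by auto
    have "h x n \<le> Max (V n)" if "n \<ge> k" for n
    proof (rule Max_ge[OF fin])
      show "h x n \<in> V n"
        using k that unfolding V_def by blast
    qed
    then have "{n. \<not> h x n \<le> Max (V n)} \<subseteq> {..<k}"
      using not_le by blast
    then show ?thesis
      unfolding le_star_def using finite_subset by blast
  qed
  then show ?thesis
    unfolding le_star_bounded_def by blast
qed

theorem proposition2p10:
  fixes X :: "'a topology"
  assumes "bounding_number \<le>o |topspace X|"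
  shows "\<not> H_nw_selective X"
proof
  assume sel: "H_nw_selective X"
  obtain B where B: "\<not> le_star_bounded B" "bounding_number = |B|"
    using bounding_number_attained by blast
  \<comment> \<open>The cardinal inequality yields a surjection onto \<open>B\<close> only for nonempty \<open>B\<close>.\<close>
  have "B \<noteq> {}"
    using B(1) by (auto simp: le_star_bounded_def)
  then obtain h where "h ` topspace X = B"
    using assms B(2) card_of_ordLeq2 by metis
  then show False
    using H_nw_selective_imp_le_star_bounded_image[OF sel, of h] B(1) by simp
qed

end
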